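(* For every positive integer $n$ there is an order oblivious protocol $\Pi$ for $G_n$ such that $\tilde{h}(\Pi)\le 3+\lceil\log_2\log_2 n\rceil$.
   Context: The game $G_n$ ($n$ a positive integer): Alice receives, as a stream, a permutation $\sigma=(\sigma_1,\dots,\sigma_n)$ of $[n]=\{1,\dots,n\}$ followed by a bit $b\in\{0,1\}$. She has an array $\mathbf{v}=(v_1,\dots,v_n)$ whose cells are initially empty. For each $i<n$, upon receiving $\sigma_i$ she writes a bit in cell $\sigma_i$; this bit may depend on $\sigma_1,\dots,\sigma_i$, and once written cannot be changed. Upon receiving $\sigma_n$ and $b$ she writes $b$ in cell $\sigma_n$. Bob receives the completed array $\mathbf{v}\in\{0,1\}^n$ and must output a set $J\subseteq[n]$ containing $\sigma_n$. A protocol is order oblivious if the bit Alice writes in cell $\sigma_i$ depends only on $\sigma_i$ and on the current partial assignment of $\mathbf{v}$ (which cells are filled and with which bits), and not on the order in which $\sigma_1,\dots,\sigma_{i-1}$ arrived. For a protocol $\Pi$ (given by Alice's writing rule), let $\sigma$ be a uniformly random permutation of $[n]$ and $b$ an independent uniformly random bit, and let $\mathbf{v}$ be the resulting completed array; $\tilde{h}(\Pi)$ is the conditional Shannon entropy (base 2) $H(\sigma_n\mid \mathbf{v})$. *)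

theory Defs
  imports Complex_Main "HOL-Combinatorics.Multiset_Permutations"
begin

text \<open>A (deterministic) protocol for Alice in the game G_n is a writing rule
  A :: nat list \<Rightarrow> bool : on the prefix [sigma_1,...,sigma_i] (i < n) of the stream
  she writes the bit  A [sigma_1,...,sigma_i]  into cell sigma_i.
  Cells are 1..n; a (partial) array is a map  nat \<Rightarrow> bool option  (None = empty).\<close>

type_synonym protocol = "nat list \<Rightarrow> bool"

definition partial_assign :: "protocol \<Rightarrow> nat list \<Rightarrow> (nat \<Rightarrow> bool option)" where
  "partial_assign A ps = map_of (zip ps (map (\<lambda>i. A (take (Suc i) ps)) [0..<length ps]))"

definition final_array :: "protocol \<Rightarrow> nat list \<Rightarrow> bool \<Rightarrow> (nat \<Rightarrow> bool option)" where
  "final_array A \<sigma> b = (partial_assign A (butlast \<sigma>))(last \<sigma> \<mapsto> b)"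

definition rule_prefixes :: "nat \<Rightarrow> nat list set" where
  "rule_prefixes n = {ps. ps \<noteq> [] \<and> distinct ps \<and> set ps \<subseteq> {1..n} \<and> length ps < n}"

definition order_oblivious :: "nat \<Rightarrow> protocol \<Rightarrow> bool" where
  "order_oblivious n A \<longleftrightarrow>
     (\<forall>ps \<in> rule_prefixes n. \<forall>qs \<in> rule_prefixes n.
        last ps = last qs \<and> partial_assign A (butlast ps) = partial_assign A (butlast qs)
        \<longrightarrow> A ps = A qs)"

text \<open>Sample space: uniformly random permutation of [n] and independent uniform bit.\<close>
definition outcomes :: "nat \<Rightarrow> (nat list \<times> bool) set" where
  "outcomes n = permutations_of_set {1..n} \<times> (UNIV :: bool set)"

definition joint_count :: "nat \<Rightarrow> protocol \<Rightarrow> nat \<Rightarrow> (nat \<Rightarrow> bool option) \<Rightarrow> nat" where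
  "joint_count n A x v = card {(\<sigma>, b) \<in> outcomes n. last \<sigma> = x \<and> final_array A \<sigma> b = v}"

definition array_count :: "nat \<Rightarrow> protocol \<Rightarrow> (nat \<Rightarrow> bool option) \<Rightarrow> nat" where
  "array_count n A v = card {(\<sigma>, b) \<in> outcomes n. final_array A \<sigma> b = v}"

text \<open>h~(Pi) = H(sigma_n | v) (base 2) written out:
  sum over v, x of p(x,v) * log2 (p(v) / p(x,v)); terms with p(x,v) = 0 vanish.\<close>
definition h_tilde :: "nat \<Rightarrow> protocol \<Rightarrow> real" where
  "h_tilde n A =
     (\<Sum>v \<in> (\<lambda>(\<sigma>, b). final_array A \<sigma> b) ` outcomes n. \<Sum>x \<in> {1..n}.
        (real (joint_count n A x v) / real (card (outcomes n))) *
        log 2 (real (array_count n A v) / real (joint_count n A x v)))"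

end

theory Submission
  imports Defs "HOL-Library.FuncSet" "HOL-Library.Z2"
begin

text \<open>Let \<open>k = 2\<^sup>l\<close> with \<open>l = \<lceil>log\<^sub>2 log\<^sub>2 n\<rceil>\<close>, so \<open>k \<ge> log\<^sub>2 n\<close>. Label the cells by vectors of length
  \<open>m = k + 1\<close> over the field with two elements: injectively and nonzero on a large set \<open>D\<close>, randomly on
  the remaining set \<open>B\<close> of about \<open>n / k\<close> cells. Alice steers the sum of the labels of the cells that
  contain 0 so that it always lies in the span of the labels of the empty cells of \<open>B\<close>, and writes
  0 whenever that is possible. If the last cell \<open>x\<close> is in \<open>D\<close>, then the sum is 0 just before the last
  step. Hence for \<open>b = 0\<close> the final sum is the label of \<open>x\<close>, which determines \<open>x\<close>; for \<open>b = 1\<close> the sum is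
  0 and \<open>x\<close> is one of the cells of \<open>D\<close> that contain 1. A 1 is written in \<open>D\<close> only when the empty
  cells of \<open>B\<close> no longer span everything, i.e. when about \<open>m\<close> of them are left, so there are at most
  about \<open>k m\<close> such cells on average, and these cost \<open>log\<^sub>2 (k m)\<close> bits, but only for \<open>b = 1\<close>, i.e. half
  of the time. The case \<open>x \<in> B\<close> has probability at most \<open>1 / k\<close> and costs at most \<open>log\<^sub>2 n \<le> k\<close> bits.\<close>

section \<open>Conditional entropy and cross entropy\<close>

text \<open>Gibbs' inequality, applied to one array \<open>v\<close> at a time: the log loss of a
  guess \<open>q\<close> is compared with the true conditional distribution through
  \<open>ln t \<le> t - 1\<close> at \<open>t = a * q x v / j x\<close>. Bounding the entropy thus
  reduces to naming a good guess for Bob.\<close>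

lemma h_tilde_le_cross_entropy:
  fixes q :: "nat \<Rightarrow> (nat \<Rightarrow> bool option) \<Rightarrow> real"
  assumes nonneg: "\<And>x v. x \<in> {1..n} \<Longrightarrow> q x v \<ge> 0"
    and pos: "\<And>\<sigma> b. \<sigma> \<in> permutations_of_set {1..n} \<Longrightarrow> q (last \<sigma>) (final_array A \<sigma> b) > 0"
    and sub: "\<And>v. (\<Sum>x\<in>{1..n}. q x v) \<le> 1"
    and "n \<ge> 1"
  shows "h_tilde n A \<le>
    (\<Sum>(\<sigma>, b)\<in>outcomes n. log 2 (1 / q (last \<sigma>) (final_array A \<sigma> b))) / card (outcomes n)"
proof -
  let ?fin = "\<lambda>(\<sigma>, b). final_array A \<sigma> b"
  let ?lst = "\<lambda>\<omega> :: nat list \<times> bool. last (fst \<omega>)"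
  define T where "T = real (card (outcomes n))"
  have fin: "finite (outcomes n)"
    unfolding outcomes_def by (intro finite_cartesian_product finite_permutations_of_set finite)
  have "outcomes n \<noteq> {}"
    by (simp add: outcomes_def)
  then have T: "T > 0"
    using fin by (simp add: T_def card_gt_0_iff)
  have last: "?lst \<omega> \<in> {1..n}" if "\<omega> \<in> outcomes n" for \<omega>
  proof -
    have "fst \<omega> \<in> permutations_of_set {1..n}"
      using that unfolding outcomes_def by (rule mem_Times_iff[THEN iffD1, THEN conjunct1])
    then have "set (fst \<omega>) = {1..n}"
      by (rule permutations_of_setD)
    moreover have "{1..n} \<noteq> {}"
      using \<open>n \<ge> 1\<close> by simp
    ultimately show ?thesis
      by (metis last_in_set set_empty)
  qed
  define O' where "O' v = {\<omega> \<in> outcomes n. ?fin \<omega> = v}" for v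
  have finO: "finite (O' v)" for v
    using fin by (simp add: O'_def)
  have jc: "joint_count n A x v = card {\<omega> \<in> O' v. ?lst \<omega> = x}" for x v
    unfolding joint_count_def O'_def by (rule arg_cong[of _ _ card]) auto
  have ac: "array_count n A v = card (O' v)" for v
    unfolding array_count_def O'_def by (rule arg_cong[of _ _ card]) auto
  have group: "(\<Sum>x\<in>{1..n}. joint_count n A x v * f x) = (\<Sum>\<omega>\<in>O' v. f (?lst \<omega>))"
    for v and f :: "nat \<Rightarrow> real"
  proof -
    have "(\<Sum>\<omega>\<in>O' v. f (?lst \<omega>)) = (\<Sum>x\<in>{1..n}. \<Sum>\<omega>\<in>{\<omega> \<in> O' v. ?lst \<omega> = x}. f (?lst \<omega>))"
      using finO last by (intro sum.group[symmetric]) (auto simp: O'_def)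
    also have "\<dots> = (\<Sum>x\<in>{1..n}. joint_count n A x v * f x)"
      by (intro sum.cong refl) (simp add: jc)
    finally show ?thesis by simp
  qed
  have gibbs: "(\<Sum>x\<in>{1..n}. joint_count n A x v * log 2 (array_count n A v / joint_count n A x v))
      \<le> (\<Sum>\<omega>\<in>O' v. log 2 (1 / q (?lst \<omega>) v))" for v
  proof -
    define j where "j x = real (joint_count n A x v)" for x
    define a where "a = real (array_count n A v)"
    have sumj: "(\<Sum>x\<in>{1..n}. j x) = a"
      using group[of v "\<lambda>_. 1"] by (simp add: j_def a_def ac)
    have "(\<Sum>x\<in>{1..n}. j x * log 2 (a / j x)) - (\<Sum>x\<in>{1..n}. j x * log 2 (1 / q x v))
        = (\<Sum>x\<in>{1..n}. j x * (log 2 (a / j x) - log 2 (1 / q x v)))"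
      by (simp add: sum_subtractf right_diff_distrib)
    also have "\<dots> \<le> (\<Sum>x\<in>{1..n}. (a * q x v - j x) / ln 2)"
    proof (rule sum_mono)
      fix x assume x: "x \<in> {1..n}"
      show "j x * (log 2 (a / j x) - log 2 (1 / q x v)) \<le> (a * q x v - j x) / ln 2"
      \<comment> \<open>If \<open>j x = 0\<close>, the factor \<open>j x\<close> kills the left side
        whatever value the division by zero has, and the right side is nonnegative.\<close>
      proof (cases "j x = 0")
        case True
        then show ?thesis
          using nonneg[OF x] by (simp add: a_def)
      next
        case False
        then have jpos: "j x > 0"
          by (simp add: j_def)
        then have "{\<omega> \<in> O' v. ?lst \<omega> = x} \<noteq> {}"
          by (metis j_def jc card.empty of_nat_0 less_irrefl)
        then obtain \<omega> where \<omega>: "\<omega> \<in> O' v" "?lst \<omega> = x"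
          by blast
        obtain \<sigma> b where \<sigma>: "\<omega> = (\<sigma>, b)"
          by (rule prod.exhaust)
        have "\<sigma> \<in> permutations_of_set {1..n}" "final_array A \<sigma> b = v" "last \<sigma> = x"
          using \<omega> by (simp_all add: \<sigma> O'_def outcomes_def)
        then have q: "q x v > 0"
          using pos by blast
        have "j x \<le> a"
          unfolding sumj[symmetric] using x by (intro member_le_sum) (simp_all add: j_def)
        then have apos: "a > 0"
          using jpos by simp
        have "log 2 (a / j x) - log 2 (1 / q x v) = ln (a * q x v / j x) / ln 2"
          using jpos q apos by (simp add: log_def ln_div ln_mult diff_divide_distrib add_divide_distrib)
        also have "\<dots> \<le> (a * q x v / j x - 1) / ln 2"
          using jpos q apos by (intro divide_right_mono ln_le_minus_one) auto
        finally have "j x * (log 2 (a / j x) - log 2 (1 / q x v)) \<le> j x * ((a * q x v / j x - 1) / ln 2)"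
          using jpos by (intro mult_left_mono) auto
        also have "\<dots> = (a * q x v - j x) / ln 2"
          using jpos by (simp add: field_simps)
        finally show ?thesis .
      qed
    qed
    also have "\<dots> = (a * (\<Sum>x\<in>{1..n}. q x v) - a) / ln 2"
      by (simp only: sum_subtractf sumj sum_divide_distrib[symmetric] sum_distrib_left[symmetric])
    also have "\<dots> \<le> 0"
    proof -
      have "a * (\<Sum>x\<in>{1..n}. q x v) \<le> a * 1"
        by (rule mult_left_mono[OF sub]) (simp add: a_def)
      then show ?thesis
        by (intro divide_nonpos_pos) simp_all
    qed
    finally have "(\<Sum>x\<in>{1..n}. j x * log 2 (a / j x)) \<le> (\<Sum>x\<in>{1..n}. j x * log 2 (1 / q x v))"
      by simp
    then show ?thesis
      unfolding j_def a_def group .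
  qed
  have "h_tilde n A = (\<Sum>v\<in>?fin ` outcomes n. \<Sum>x\<in>{1..n}.
      joint_count n A x v * log 2 (array_count n A v / joint_count n A x v)) / T"
    by (simp add: h_tilde_def T_def sum_divide_distrib)
  also have "\<dots> \<le> (\<Sum>v\<in>?fin ` outcomes n. \<Sum>\<omega>\<in>O' v. log 2 (1 / q (?lst \<omega>) v)) / T"
    using T by (intro divide_right_mono sum_mono gibbs) simp
  also have "(\<Sum>v\<in>?fin ` outcomes n. \<Sum>\<omega>\<in>O' v. log 2 (1 / q (?lst \<omega>) v)) =
      (\<Sum>v\<in>?fin ` outcomes n. \<Sum>\<omega>\<in>{\<omega> \<in> outcomes n. ?fin \<omega> = v}. log 2 (1 / q (?lst \<omega>) (?fin \<omega>)))"
    by (intro sum.cong) (simp_all only: O'_def mem_Collect_eq)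
  also have "\<dots> = (\<Sum>\<omega>\<in>outcomes n. log 2 (1 / q (?lst \<omega>) (?fin \<omega>)))"
    using fin by (intro sum.group) simp_all
  finally show ?thesis
    by (simp add: T_def case_prod_unfold)
qed

section \<open>Protocols given by a rule on partial arrays\<close>

definition run :: "((nat \<Rightarrow> bool option) \<Rightarrow> nat \<Rightarrow> bool) \<Rightarrow> nat list \<Rightarrow> nat \<Rightarrow> bool option" where
  "run g ps = foldl (\<lambda>f x. f(x \<mapsto> g f x)) Map.empty ps"

definition oblivious_protocol :: "((nat \<Rightarrow> bool option) \<Rightarrow> nat \<Rightarrow> bool) \<Rightarrow> protocol" where
  "oblivious_protocol g ps = g (run g (butlast ps)) (last ps)"

lemma run_Nil [simp]: "run g [] = Map.empty"
  by (simp add: run_def)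

lemma run_snoc [simp]: "run g (ps @ [x]) = (run g ps)(x \<mapsto> g (run g ps) x)"
  by (simp add: run_def)

lemma dom_run [simp]: "dom (run g ps) = set ps"
proof (induction ps rule: rev_induct)
  case (snoc x ps)
  then show ?case
    by (simp only: run_snoc dom_fun_upd) simp
qed simp

lemma partial_assign_oblivious_protocol:
  assumes "distinct ps"
  shows "partial_assign (oblivious_protocol g) ps = run g ps"
  using assms
proof (induction ps rule: rev_induct)
  case Nil
  then show ?case by (simp add: partial_assign_def)
next
  case (snoc x ps)
  let ?A = "oblivious_protocol g"
  have "map (\<lambda>i. ?A (take (Suc i) (ps @ [x]))) [0..<length ps] =
        map (\<lambda>i. ?A (take (Suc i) ps)) [0..<length ps]"
    by (rule map_cong) auto
  then have "partial_assign ?A (ps @ [x]) = [x \<mapsto> ?A (ps @ [x])] ++ partial_assign ?A ps"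
    unfolding partial_assign_def by (simp del: take_append map_eq_conv)
  also have "\<dots> = (run g ps)(x \<mapsto> g (run g ps) x)"
  proof -
    \<comment> \<open>In \<open>map_of\<close> earlier pairs win, so the new pair sits below the old
      ones; as \<open>x\<close> is new, the domains are disjoint and the two maps commute.\<close>
    have "[x \<mapsto> ?A (ps @ [x])] ++ run g ps = run g ps ++ [x \<mapsto> ?A (ps @ [x])]"
      using snoc.prems by (intro map_add_comm) auto
    then show ?thesis
      using snoc oblivious_protocol_def[of g "ps @ [x]"] by simp
  qed
  finally show ?case by simp
qed

text \<open>The rule sees the prefix only through \<open>run g (butlast ps)\<close>, which is the
  current partial array itself. So every rule \<open>g\<close> on partial arrays qualifies.\<close>

lemma order_oblivious_oblivious_protocol: "order_oblivious n (oblivious_protocol g)"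
  unfolding order_oblivious_def rule_prefixes_def
  by (auto simp: partial_assign_oblivious_protocol distinct_butlast oblivious_protocol_def)

lemma run_append_Cons:
  assumes "distinct (ps @ y # qs)"
  shows "run g (ps @ y # qs) y = Some (g (run g ps) y)"
  using assms
proof (induction qs rule: rev_induct)
  case (snoc z qs)
  then show ?case
    using run_snoc[of g "ps @ y # qs" z] by (auto simp del: run_snoc)
qed simp

section \<open>Spans over the field with two elements\<close>

declare add_bit_eq_xor [simp del] mult_bit_eq_and [simp del]

text \<open>Vectors are functions on all of \<open>nat\<close> whose coordinates from
  \<open>m\<close> on are ignored. The first argument mostly plays the role of a linear
  functional.\<close>

definition dot :: "nat \<Rightarrow> (nat \<Rightarrow> bit) \<Rightarrow> (nat \<Rightarrow> bit) \<Rightarrow> bit" where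
  "dot m \<chi> t = (\<Sum>i<m. \<chi> i * t i)"

lemma dot_add_right: "dot m \<chi> (\<lambda>i. s i + t i) = dot m \<chi> s + dot m \<chi> t"
  by (simp add: dot_def algebra_simps sum.distrib)

lemma dot_add_left: "dot m (\<lambda>i. \<chi> i + \<psi> i) t = dot m \<chi> t + dot m \<psi> t"
  by (simp add: dot_def algebra_simps sum.distrib)

lemma dot_cong: "(\<And>i. i < m \<Longrightarrow> \<chi> i = \<psi> i) \<Longrightarrow> dot m \<chi> t = dot m \<psi> t"
  by (simp add: dot_def)

lemma dot_commute: "dot m \<chi> t = dot m t \<chi>"
  by (simp add: dot_def mult.commute)

lemma dot_unit:
  assumes "i < m"
  shows "dot m (\<lambda>j. if j = i then 1 else 0) t = t i"
proof -
  have "dot m (\<lambda>j. if j = i then 1 else 0) t = (\<Sum>j<m. if j = i then t j else 0)"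
    unfolding dot_def by (intro sum.cong refl) simp
  also have "\<dots> = t i"
    using assms by simp
  finally show ?thesis .
qed

text \<open>The span of the labels \<open>c r\<close>, \<open>r \<in> R\<close>, given as its double annihilator. This form makes both the exchange step
  \<open>lspan_remove\<close> and the union bound \<open>card_not_lspan_le\<close> immediate.\<close>

definition lspan :: "nat \<Rightarrow> (nat \<Rightarrow> nat \<Rightarrow> bit) \<Rightarrow> nat set \<Rightarrow> (nat \<Rightarrow> bit) set" where
  "lspan m c R = {t. \<forall>\<chi>. (\<forall>r\<in>R. dot m \<chi> (c r) = 0) \<longrightarrow> dot m \<chi> t = 0}"

lemma lspan_empty_iff: "t \<in> lspan m c {} \<longleftrightarrow> (\<forall>i<m. t i = 0)"
proof
  assume t: "t \<in> lspan m c {}"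
  show "\<forall>i<m. t i = 0"
  proof (intro allI impI)
    fix i assume "i < m"
    have "dot m (\<lambda>j. if j = i then 1 else 0) t = 0"
      using t by (simp add: lspan_def)
    then show "t i = 0"
      by (simp only: dot_unit[OF \<open>i < m\<close>])
  qed
qed (simp add: lspan_def dot_def)

lemma lspan_add_iff:
  assumes "s \<in> lspan m c R"
  shows "(\<lambda>i. s i + t i) \<in> lspan m c R \<longleftrightarrow> t \<in> lspan m c R"
proof -
  have "dot m \<chi> (\<lambda>i. s i + t i) = dot m \<chi> t" if "\<forall>r\<in>R. dot m \<chi> (c r) = 0" for \<chi>
    using assms that by (simp add: lspan_def dot_add_right)
  then show ?thesis
    by (simp add: lspan_def)
qed

text \<open>Over two elements, \<open>t\<close> in the span of \<open>R\<close> is \<open>s\<close>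
  or \<open>s + c a\<close> with \<open>s\<close> in the span of \<open>R - {a}\<close>, so
  \<open>t\<close> or \<open>t + c a\<close> lies in the smaller span. The proof is the dual form:
  functionals witnessing that both fail are combined into one that contradicts the assumption on
  \<open>t\<close>.\<close>

lemma lspan_remove:
  assumes t: "t \<in> lspan m c R" and nt: "(\<lambda>i. t i + c a i) \<notin> lspan m c (R - {a})"
  shows "t \<in> lspan m c (R - {a})"
proof (rule ccontr)
  assume "t \<notin> lspan m c (R - {a})"
  then obtain \<chi> where \<chi>: "\<forall>r\<in>R - {a}. dot m \<chi> (c r) = 0" "dot m \<chi> t = 1"
    by (auto simp: lspan_def)
  obtain \<psi> where \<psi>: "\<forall>r\<in>R - {a}. dot m \<psi> (c r) = 0" "dot m \<psi> t + dot m \<psi> (c a) = 1"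
    using nt by (auto simp: lspan_def dot_add_right)
  have *: "dot m \<phi> (c a) \<noteq> 0" if "\<forall>r\<in>R - {a}. dot m \<phi> (c r) = 0" "dot m \<phi> t = 1" for \<phi>
  proof
    assume "dot m \<phi> (c a) = 0"
    then have "\<forall>r\<in>R. dot m \<phi> (c r) = 0"
      using that by blast
    then show False
      using t that by (simp add: lspan_def)
  qed
  have \<chi>a: "dot m \<chi> (c a) = 1"
    using *[OF \<chi>] by simp
  have \<psi>a: "dot m \<psi> (c a) = 1" "dot m \<psi> t = 0"
    using *[of \<psi>] \<psi> by (cases "dot m \<psi> t"; cases "dot m \<psi> (c a)"; simp)+
  \<comment> \<open>The sum of the functionals is 1 at \<open>t\<close> and vanishes on
    \<open>R - {a}\<close>, so \<open>*\<close> applies to it; yet both summands are 1 at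
    \<open>c a\<close>.\<close>
  have "dot m (\<lambda>i. \<chi> i + \<psi> i) (c a) \<noteq> 0"
    using \<chi> \<psi> \<psi>a by (intro *) (auto simp: dot_add_left)
  then show False
    using \<chi>a \<psi>a by (simp add: dot_add_left)
qed

lemma UNIV_bit: "(UNIV :: bit set) = {0, 1}"
proof (rule set_eqI)
  show "x \<in> UNIV \<longleftrightarrow> x \<in> {0, 1}" for x :: bit
    by (cases x) simp_all
qed

definition bvecs :: "nat \<Rightarrow> (nat \<Rightarrow> bit) set" where
  "bvecs m = {..<m} \<rightarrow>\<^sub>E UNIV"

lemma card_bvecs: "card (bvecs m) = 2 ^ m"
  by (simp add: bvecs_def card_PiE UNIV_bit numeral_2_eq_2)

lemma finite_bvecs [simp]: "finite (bvecs m)"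
  unfolding bvecs_def by (rule finite_PiE) (simp_all add: UNIV_bit)

lemma bvecs_eqI:
  assumes "s \<in> bvecs m" "t \<in> bvecs m" "\<And>i. i < m \<Longrightarrow> s i = t i"
  shows "s = t"
  using assms unfolding bvecs_def by (intro PiE_ext) auto

text \<open>Flipping coordinate \<open>i\<close> toggles the value of the functional, so it pairs
  the kernel with its complement.\<close>

lemma card_dot_kernel:
  assumes i: "i < m" "\<chi> i = 1"
  shows "2 * card {v \<in> bvecs m. dot m \<chi> v = 0} = 2 ^ m"
proof -
  let ?K = "\<lambda>b. {v \<in> bvecs m. dot m \<chi> v = b}"
  let ?f = "\<lambda>v :: nat \<Rightarrow> bit. v(i := v i + 1)"
  have dot: "dot m \<chi> (?f v) = dot m \<chi> v + 1" for v
  proof -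
    have "?f v = (\<lambda>j. v j + (if j = i then 1 else 0))"
      by auto
    moreover have "dot m \<chi> (\<lambda>j. if j = i then 1 else 0) = 1"
      using i dot_unit[of i m \<chi>] dot_commute by metis
    ultimately show ?thesis
      by (simp only: dot_add_right)
  qed
  have f: "?f v \<in> bvecs m" if "v \<in> bvecs m" for v
    using that i by (auto simp: bvecs_def PiE_iff extensional_def)
  have add: "b + 1 + 1 = b" for b :: bit
    by (cases b) simp_all
  have ff: "?f (?f v) = v" for v
    by (simp add: add)
  have "bij_betw ?f (?K 0) (?K 1)"
  proof (rule bij_betwI[of _ _ _ ?f])
    show "?f \<in> ?K 0 \<rightarrow> ?K 1" "?f \<in> ?K 1 \<rightarrow> ?K 0"
      using f dot by simp_all
  qed (simp_all only: ff)
  then have "card (?K 0) = card (?K 1)"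
    by (rule bij_betw_same_card)
  moreover have "card (?K 0 \<union> ?K 1) = card (?K 0) + card (?K 1)"
    by (rule card_Un_disjoint) auto
  moreover have "?K 0 \<union> ?K 1 = bvecs m"
    by auto
  ultimately show ?thesis
    using card_bvecs[of m] by (simp only: mult_2)
qed

lemma lspan_cong: "(\<And>r. r \<in> R \<Longrightarrow> c r = c' r) \<Longrightarrow> lspan m c R = lspan m c' R"
  by (simp add: lspan_def)

text \<open>Union bound over functionals: if \<open>t\<close> is outside the span, some functional
  vanishes on all labels of \<open>R\<close> but not at \<open>t\<close>. There are at most
  \<open>2 ^ m\<close> of them, and a fixed nonzero one kills \<open>card R\<close> independent
  random labels with probability \<open>1 / 2 ^ card R\<close>.\<close>

lemma card_not_lspan_le:
  assumes A: "finite A" and R: "R \<subseteq> A"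
  shows "real (card {r \<in> A \<rightarrow>\<^sub>E bvecs m. t \<notin> lspan m r R})
    \<le> 2 ^ m / 2 ^ card R * card (A \<rightarrow>\<^sub>E bvecs m)"
proof -
  define X where "X = {\<chi> \<in> bvecs m. \<exists>i<m. \<chi> i = 1}"
  define K where "K \<chi> = {v \<in> bvecs m. dot m \<chi> v = 0}" for \<chi>
  define S where "S \<chi> = (\<Pi>\<^sub>E a\<in>A. if a \<in> R then K \<chi> else bvecs m)" for \<chi>
  have finX: "finite X"
    by (simp add: X_def)
  have finS: "finite (S \<chi>)" for \<chi>
    unfolding S_def using A by (intro finite_PiE) (simp_all add: K_def)
  have "{r \<in> A \<rightarrow>\<^sub>E bvecs m. t \<notin> lspan m r R} \<subseteq> (\<Union>\<chi>\<in>X. S \<chi>)"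
  proof
    fix r assume r: "r \<in> {r \<in> A \<rightarrow>\<^sub>E bvecs m. t \<notin> lspan m r R}"
    then obtain \<psi> where \<psi>: "\<forall>a\<in>R. dot m \<psi> (r a) = 0" "dot m \<psi> t = 1"
      by (auto simp: lspan_def)
    \<comment> \<open>Cutting the functional down to its first \<open>m\<close> coordinates makes it
      one of the finitely many in \<open>bvecs m\<close> without changing its values.\<close>
    define \<chi> where "\<chi> = restrict \<psi> {..<m}"
    have dot: "dot m \<chi> s = dot m \<psi> s" for s
      by (rule dot_cong) (simp add: \<chi>_def)
    have "\<chi> \<in> bvecs m"
      by (simp add: \<chi>_def bvecs_def)
    moreover have "\<exists>i<m. \<chi> i = 1"
    proof (rule ccontr)
      assume "\<not> (\<exists>i<m. \<chi> i = 1)"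
      then have "dot m \<chi> t = 0"
        by (simp add: dot_def)
      then show False
        using dot \<psi> by simp
    qed
    ultimately have "\<chi> \<in> X"
      by (simp add: X_def)
    moreover have "r \<in> S \<chi>"
      using r \<psi>(1) R by (auto simp: S_def K_def PiE_iff dot)
    ultimately show "r \<in> (\<Union>\<chi>\<in>X. S \<chi>)"
      by blast
  qed
  then have "card {r \<in> A \<rightarrow>\<^sub>E bvecs m. t \<notin> lspan m r R} \<le> card (\<Union>\<chi>\<in>X. S \<chi>)"
    using finX finS by (intro card_mono) auto
  also have "\<dots> \<le> (\<Sum>\<chi>\<in>X. card (S \<chi>))"
    by (rule card_UN_le[OF finX])
  finally have "real (card {r \<in> A \<rightarrow>\<^sub>E bvecs m. t \<notin> lspan m r R}) \<le> (\<Sum>\<chi>\<in>X. real (card (S \<chi>)))"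
    unfolding of_nat_sum[symmetric] of_nat_le_iff .
  also have "\<dots> = (\<Sum>\<chi>\<in>X. real (card (A \<rightarrow>\<^sub>E bvecs m)) / 2 ^ card R)"
  proof (rule sum.cong[OF refl])
    fix \<chi> assume "\<chi> \<in> X"
    then have "2 * card (K \<chi>) = 2 ^ m"
      using card_dot_kernel unfolding X_def K_def by blast
    then have "2 * real (card (K \<chi>)) = 2 ^ m"
      by (metis of_nat_mult of_nat_numeral of_nat_power)
    then have K: "real (card (K \<chi>)) = 2 ^ m * (1 / 2)"
      by simp
    have "real (card (S \<chi>)) = (\<Prod>a\<in>A. real (card (if a \<in> R then K \<chi> else bvecs m)))"
      using A by (simp add: S_def card_PiE)
    also have "\<dots> = (\<Prod>a\<in>A. 2 ^ m * (if a \<in> R then 1 / 2 else 1))"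
      by (intro prod.cong refl) (simp add: K card_bvecs)
    also have "\<dots> = (2 ^ m) ^ card A * (1 / 2) ^ card R"
      using A R by (simp add: prod.distrib prod.If_cases Int_absorb1)
    also have "\<dots> = real (card (A \<rightarrow>\<^sub>E bvecs m)) / 2 ^ card R"
      using A by (simp add: card_PiE card_bvecs power_one_over)
    finally show "real (card (S \<chi>)) = real (card (A \<rightarrow>\<^sub>E bvecs m)) / 2 ^ card R" .
  qed
  also have "\<dots> = card X * (real (card (A \<rightarrow>\<^sub>E bvecs m)) / 2 ^ card R)"
    by simp
  also have "\<dots> \<le> 2 ^ m * (real (card (A \<rightarrow>\<^sub>E bvecs m)) / 2 ^ card R)"
  proof (rule mult_right_mono)
    have "card X \<le> card (bvecs m)"
      unfolding X_def by (intro card_mono) auto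
    then show "real (card X) \<le> 2 ^ m"
      by (metis card_bvecs of_nat_le_iff of_nat_numeral of_nat_power)
  qed simp
  finally show ?thesis
    by simp
qed

section \<open>Cells behind a given cell in a random permutation\<close>

text \<open>For \<open>y\<close> in a distinct list: the cells still empty when \<open>y\<close>
  arrives, apart from \<open>y\<close> itself.\<close>

definition behind :: "'a list \<Rightarrow> 'a \<Rightarrow> 'a set" where
  "behind \<sigma> y = set (takeWhile (\<lambda>z. z \<noteq> y) (rev \<sigma>))"

lemma behind_append_Cons: "y \<notin> set qs \<Longrightarrow> behind (ps @ y # qs) y = set qs"
  by (auto simp: behind_def takeWhile_append)

lemma finite_behind [simp]: "finite (behind \<sigma> y)"
  by (simp add: behind_def)

lemma behind_map:
  assumes "inj f"
  shows "behind (map f \<sigma>) (f y) = f ` behind \<sigma> y"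
  using assms by (simp add: behind_def rev_map takeWhile_map o_def inj_eq)

lemma behind_cases:
  assumes "distinct \<sigma>" "x \<in> set \<sigma>" "y \<in> set \<sigma>" "x \<noteq> y"
  shows "insert x (behind \<sigma> x) \<subseteq> behind \<sigma> y \<or> insert y (behind \<sigma> y) \<subseteq> behind \<sigma> x"
proof -
  obtain ps qs where \<sigma>: "\<sigma> = ps @ x # qs"
    using split_list[OF assms(2)] by blast
  have *: "behind \<sigma> x = set qs"
    using assms by (auto simp: \<sigma> behind_append_Cons)
  show ?thesis
  proof (cases "y \<in> set qs")
    case True
    then obtain qs1 qs2 where qs: "qs = qs1 @ y # qs2"
      using split_list by metis
    have "behind \<sigma> y = set qs2"
      using assms behind_append_Cons[of y qs2 "ps @ x # qs1"] by (simp add: \<sigma> qs)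
    then show ?thesis
      using * qs by auto
  next
    case False
    then obtain ps1 ps2 where ps: "ps = ps1 @ y # ps2"
      using split_list[of y ps] assms by (auto simp: \<sigma>)
    have "behind \<sigma> y = set ps2 \<union> {x} \<union> set qs"
      using assms behind_append_Cons[of y "ps2 @ x # qs" ps1] by (auto simp: \<sigma> ps)
    then show ?thesis
      using * by auto
  qed
qed

lemma behind_subset: "behind \<sigma> y \<subseteq> set \<sigma> - {y}"
  by (auto simp: behind_def dest: set_takeWhileD)

text \<open>The count is the rank of \<open>y\<close> within \<open>B\<close>, from the end of the
  list: a later cell has a strictly smaller count.\<close>

lemma bij_betw_card_behind:
  assumes \<sigma>: "distinct \<sigma>" and B: "finite B" "B \<subseteq> set \<sigma>"
  shows "bij_betw (\<lambda>y. card (B \<inter> behind \<sigma> y)) B {..<card B}"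
proof -
  let ?r = "\<lambda>y. card (B \<inter> behind \<sigma> y)"
  have less: "?r x < ?r y" if "insert x (behind \<sigma> x) \<subseteq> behind \<sigma> y" "x \<in> B" for x y
    using that behind_subset[of \<sigma> x] by (intro psubset_card_mono) auto
  have "inj_on ?r B"
  proof (rule inj_onI, rule ccontr)
    fix x y assume "x \<in> B" "y \<in> B" "?r x = ?r y" "x \<noteq> y"
    then show False
      using behind_cases[OF \<sigma>, of x y] B less[of x y] less[of y x] by auto
  qed
  moreover have "?r ` B \<subseteq> {..<card B}"
    using B behind_subset[of \<sigma>] by (auto intro!: psubset_card_mono)
  ultimately show ?thesis
    using B by (simp add: bij_betw_def card_image card_subset_eq)
qed

text \<open>The rank of \<open>y\<close> within \<open>B\<close> is uniform. Swapping two cells of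
  \<open>B\<close> shows that each has rank \<open>j\<close> equally often, and in every permutation
  exactly one cell of \<open>B\<close> has rank \<open>j\<close>; double counting gives the
  claim.\<close>

lemma card_permutations_behind:
  assumes S: "finite S" and B: "B \<subseteq> S" and y: "y \<in> B" and j: "j < card B"
  shows "card {\<sigma> \<in> permutations_of_set S. card (B \<inter> behind \<sigma> y) = j} * card B = fact (card S)"
proof -
  let ?P = "permutations_of_set S"
  let ?E = "\<lambda>y. {\<sigma> \<in> ?P. card (B \<inter> behind \<sigma> y) = j}"
  have finB: "finite B"
    using S B finite_subset by blast
  have le: "card (?E x) \<le> card (?E z)" if "x \<in> B" "z \<in> B" for x z
  proof (rule card_inj_on_le)
    let ?\<tau> = "transpose x z"
    have perm: "?\<tau> permutes S" "?\<tau> ` B = B"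
      using that B by (auto intro!: permutes_swap_id permutes_image)
    show "inj_on (map ?\<tau>) (?E x)"
      by (rule inj_on_subset[OF inj_mapI]) auto
    show "map ?\<tau> ` ?E x \<subseteq> ?E z"
    proof safe
      fix \<sigma> assume \<sigma>: "\<sigma> \<in> ?P"
      show "map ?\<tau> \<sigma> \<in> ?P"
        using permutations_of_set_image_permutes[OF perm(1)] \<sigma> by blast
      have "B \<inter> behind (map ?\<tau> \<sigma>) z = ?\<tau> ` (B \<inter> behind \<sigma> x)"
        using behind_map[of ?\<tau> \<sigma> x] perm(2) by (simp add: image_Int)
      then show "card (B \<inter> behind (map ?\<tau> \<sigma>) z) = card (B \<inter> behind \<sigma> x)"
        by (simp add: card_image)
    qed
  qed (use S in simp)
  have eq: "card (?E x) = card (?E y)" if "x \<in> B" for x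
    using le[OF that y] le[OF y that] by simp
  have "card (?E y) * card B = (\<Sum>x\<in>B. card (?E x))"
    using eq by simp
  also have "\<dots> = card (SIGMA x:B. ?E x)"
    using finB S by simp
  also have "\<dots> = (\<Sum>x\<in>B. \<Sum>\<sigma>\<in>?P. if card (B \<inter> behind \<sigma> x) = j then 1 else 0)"
    using finB S by (simp add: sum.If_cases Int_def)
  also have "\<dots> = (\<Sum>\<sigma>\<in>?P. \<Sum>x\<in>B. if card (B \<inter> behind \<sigma> x) = j then 1 else 0)"
    by (rule sum.swap)
  also have "\<dots> = (\<Sum>\<sigma>\<in>?P. 1)"
  proof (rule sum.cong[OF refl])
    fix \<sigma> assume "\<sigma> \<in> ?P"
    then have "bij_betw (\<lambda>y. card (B \<inter> behind \<sigma> y)) B {..<card B}"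
      using B finB by (intro bij_betw_card_behind) (auto simp: permutations_of_set_def)
    then show "(\<Sum>x\<in>B. if card (B \<inter> behind \<sigma> x) = j then 1 else (0::nat)) = 1"
      using sum.reindex_bij_betw[of _ B "{..<card B}" "\<lambda>i. if i = j then 1 else 0 :: nat"] j
      by simp
  qed
  also have "\<dots> = fact (card S)"
    using S by simp
  finally show ?thesis .
qed

lemma card_permutations_last:
  assumes S: "finite S" and x: "x \<in> S"
  shows "card {\<sigma> \<in> permutations_of_set S. last \<sigma> = x} * card S = fact (card S)"
proof -
  have eq: "last \<sigma> = x \<longleftrightarrow> card (S \<inter> behind \<sigma> x) = 0" if "\<sigma> \<in> permutations_of_set S" for \<sigma>
  proof -
    have \<sigma>: "set \<sigma> = S" "distinct \<sigma>"
      using that by (auto simp: permutations_of_set_def)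
    then obtain ps qs where pq: "\<sigma> = ps @ x # qs"
      using split_list x by metis
    have "x \<notin> set qs"
      using \<sigma>(2) by (simp add: pq)
    then have b: "behind \<sigma> x = set qs"
      unfolding pq by (rule behind_append_Cons)
    have "S \<inter> behind \<sigma> x = set qs"
      unfolding b using \<sigma>(1) by (auto simp: pq)
    moreover have "last \<sigma> = x \<longleftrightarrow> qs = []"
      using \<open>x \<notin> set qs\<close> last_in_set[of qs] by (auto simp: pq)
    ultimately show ?thesis
      by simp
  qed
  have "{\<sigma> \<in> permutations_of_set S. last \<sigma> = x} =
      {\<sigma> \<in> permutations_of_set S. card (S \<inter> behind \<sigma> x) = 0}"
    by (intro Collect_cong conj_cong refl eq)
  moreover have "0 < card S"
    using S x by (auto simp: card_gt_0_iff)
  ultimately show ?thesis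
    using card_permutations_behind[OF S order.refl x, of 0] by simp
qed

section \<open>Averaging over random labels of \<open>B\<close>\<close>

text \<open>The terms with \<open>j \<le> m\<close> contribute at most \<open>m + 1\<close>; the
  remaining ones form a geometric tail of total at most 1.\<close>

lemma sum_min_one_le: "(\<Sum>j<N. min 1 (2 ^ m / 2 ^ j :: real)) \<le> m + 2"
proof -
  let ?g = "\<lambda>j. min 1 (2 ^ m / 2 ^ j :: real)"
  have *: "(\<Sum>j<m + 1 + i. ?g j) \<le> m + 2 - (1 / 2) ^ i" for i
  proof (induction i)
    case 0
    have "(\<Sum>j<m + 1. ?g j) \<le> (\<Sum>j<m + 1. 1)"
      by (rule sum_mono) simp
    then show ?case by simp
  next
    case (Suc i)
    have "?g (m + 1 + i) \<le> (1 / 2) ^ Suc i"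
      by (simp add: power_add power_one_over min_def field_simps)
    then show ?case
      using Suc by simp
  qed
  have "(\<Sum>j<N. ?g j) \<le> (\<Sum>j<m + 1 + N. ?g j)"
    by (rule sum_mono2) auto
  also have "\<dots> \<le> m + 2"
    using *[of N] by (smt (verit) zero_le_power divide_nonneg_nonneg)
  finally show ?thesis .
qed

text \<open>In the setting of \<open>bet_final_array\<close> this is the number of ones in
  \<open>D\<close> when \<open>b\<close> is 1, the last cell included. It depends on the order only
  through the cells of \<open>B\<close> behind each \<open>y\<close>, which allows averaging over
  random labels.\<close>

definition late_count :: "nat \<Rightarrow> (nat \<Rightarrow> nat \<Rightarrow> bit) \<Rightarrow> nat set \<Rightarrow> nat set \<Rightarrow> nat list \<Rightarrow> nat" where
  "late_count m c D B \<sigma> = card {y \<in> D. c y \<notin> lspan m c (B \<inter> behind \<sigma> y)}"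

text \<open>The number of cells of \<open>B\<close> behind an outside cell \<open>y\<close> is the
  rank of \<open>y\<close> in \<open>insert y B\<close>, hence uniform on \<open>card B + 1\<close>
  values.\<close>

lemma sum_permutations_behind:
  fixes g :: "nat \<Rightarrow> real"
  assumes S: "finite S" and B: "B \<subseteq> S" and y: "y \<in> S - B"
  shows "(\<Sum>\<sigma>\<in>permutations_of_set S. g (card (B \<inter> behind \<sigma> y))) =
    fact (card S) / (card B + 1) * (\<Sum>j<card B + 1. g j)"
proof -
  let ?P = "permutations_of_set S"
  have finB: "finite B"
    using S B finite_subset by blast
  have card: "real (card {\<sigma> \<in> ?P. card (B \<inter> behind \<sigma> y) = j}) = fact (card S) / (card B + 1)"
    if "j < card B + 1" for j
  proof -
    have "insert y B \<inter> behind \<sigma> y = B \<inter> behind \<sigma> y" for \<sigma>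
      using behind_subset[of \<sigma> y] by blast
    moreover have "card (insert y B) = card B + 1"
      using y finB by simp
    ultimately have "card {\<sigma> \<in> ?P. card (B \<inter> behind \<sigma> y) = j} * (card B + 1) = fact (card S)"
      using card_permutations_behind[OF S, of "insert y B" y j] B y that by simp
    then have "real (card {\<sigma> \<in> ?P. card (B \<inter> behind \<sigma> y) = j}) * (card B + 1) = fact (card S)"
      by (metis of_nat_fact of_nat_mult)
    then show ?thesis
      by (simp add: eq_divide_eq)
  qed
  have "(\<Sum>\<sigma>\<in>?P. g (card (B \<inter> behind \<sigma> y))) =
      (\<Sum>j<card B + 1. \<Sum>\<sigma>\<in>{\<sigma> \<in> ?P. card (B \<inter> behind \<sigma> y) = j}. g (card (B \<inter> behind \<sigma> y)))"
  proof (rule sum.group[symmetric])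
    show "finite ?P" by (rule finite_permutations_of_set)
    show "(\<lambda>\<sigma>. card (B \<inter> behind \<sigma> y)) ` ?P \<subseteq> {..<card B + 1}"
      using finB by (auto intro!: le_imp_less_Suc card_mono)
  qed simp
  also have "\<dots> = (\<Sum>j<card B + 1. fact (card S) / (card B + 1) * g j)"
    using card by (intro sum.cong refl) simp
  also have "\<dots> = fact (card S) / (card B + 1) * (\<Sum>j<card B + 1. g j)"
    by (rule sum_distrib_left[symmetric])
  finally show ?thesis .
qed

text \<open>First moment method: the right side bounds the average over all labellings of
  \<open>B\<close>, so some labelling attains it. The labels on \<open>D\<close> are prescribed by
  \<open>e\<close>.\<close>

lemma exists_labelling:
  assumes S: "finite S" and DB: "D \<union> B \<subseteq> S" "D \<inter> B = {}"
  shows "\<exists>c. (\<forall>y\<in>D. c y = e y) \<and>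
    (\<Sum>\<sigma>\<in>permutations_of_set S. real (late_count m c D B \<sigma>))
      \<le> card D * (fact (card S) / (card B + 1) * real (m + 2))"
proof -
  let ?P = "permutations_of_set S"
  let ?L = "B \<rightarrow>\<^sub>E bvecs m"
  define U where "U = card D * (fact (card S) / (card B + 1) * real (m + 2))"
  define c where "c r y = (if y \<in> D then e y else r y)" for r :: "nat \<Rightarrow> nat \<Rightarrow> bit" and y
  let ?F = "\<lambda>r. \<Sum>\<sigma>\<in>?P. real (late_count m (c r) D B \<sigma>)"
  have fin: "finite B" "finite D"
    using S DB finite_subset by auto
  then have finL: "finite ?L"
    by (intro finite_PiE) simp_all
  have "bvecs m \<noteq> {}"
    by (simp add: bvecs_def PiE_eq_empty_iff)
  then have neL: "?L \<noteq> {}"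
    by (simp add: PiE_eq_empty_iff)
  have cnt: "real (late_count m (c r) D B \<sigma>) = (\<Sum>y\<in>D. of_bool (e y \<notin> lspan m r (B \<inter> behind \<sigma> y)))"
    for r \<sigma>
  proof -
    have "lspan m (c r) (B \<inter> behind \<sigma> y) = lspan m r (B \<inter> behind \<sigma> y)" for y
      using DB(2) by (intro lspan_cong) (auto simp: c_def)
    then have "late_count m (c r) D B \<sigma> = card {y \<in> D. e y \<notin> lspan m r (B \<inter> behind \<sigma> y)}"
      unfolding late_count_def by (intro arg_cong[of _ _ card] Collect_cong conj_cong) (simp_all add: c_def)
    then show ?thesis
      using fin by (simp add: sum.If_cases of_bool_def Int_def)
  qed
  \<comment> \<open>The union bound says nothing when \<open>card R \<le> m\<close>; there the
    trivial bound 1 takes over.\<close>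
  have miss: "(\<Sum>r\<in>?L. of_bool (t \<notin> lspan m r R)) \<le> card ?L * min 1 (2 ^ m / 2 ^ card R :: real)"
    if "R \<subseteq> B" for t R
  proof -
    have eq: "(\<Sum>r\<in>?L. of_bool (t \<notin> lspan m r R)) = real (card {r \<in> ?L. t \<notin> lspan m r R})"
      using finL by (simp add: sum.If_cases of_bool_def Int_def)
    have "card {r \<in> ?L. t \<notin> lspan m r R} \<le> card ?L"
      using finL by (intro card_mono) auto
    then show ?thesis
      using card_not_lspan_le[OF fin(1) that, of m t] unfolding eq
      by (simp add: min_def mult.commute)
  qed
  have behind: "(\<Sum>\<sigma>\<in>?P. min 1 (2 ^ m / 2 ^ card (B \<inter> behind \<sigma> y)) :: real) =
    fact (card S) / (card B + 1) * (\<Sum>j<card B + 1. min 1 (2 ^ m / 2 ^ j))" if "y \<in> D" for y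
    using that DB by (intro sum_permutations_behind[OF S]) auto
  \<comment> \<open>The sums are reordered so that labels are averaged first, for a fixed
    permutation and hence a fixed set of cells behind \<open>y\<close>; only then does the rank of
    \<open>y\<close> vary.\<close>
  have "(\<Sum>r\<in>?L. ?F r) = (\<Sum>r\<in>?L. \<Sum>\<sigma>\<in>?P. \<Sum>y\<in>D. of_bool (e y \<notin> lspan m r (B \<inter> behind \<sigma> y)))"
    by (simp only: cnt)
  also have "\<dots> = (\<Sum>\<sigma>\<in>?P. \<Sum>r\<in>?L. \<Sum>y\<in>D. of_bool (e y \<notin> lspan m r (B \<inter> behind \<sigma> y)))"
    by (rule sum.swap)
  also have "\<dots> = (\<Sum>\<sigma>\<in>?P. \<Sum>y\<in>D. \<Sum>r\<in>?L. of_bool (e y \<notin> lspan m r (B \<inter> behind \<sigma> y)))"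
    by (intro sum.cong refl sum.swap)
  also have "\<dots> = (\<Sum>y\<in>D. \<Sum>\<sigma>\<in>?P. \<Sum>r\<in>?L. of_bool (e y \<notin> lspan m r (B \<inter> behind \<sigma> y)))"
    by (rule sum.swap)
  also have "\<dots> \<le> (\<Sum>y\<in>D. \<Sum>\<sigma>\<in>?P. card ?L * min 1 (2 ^ m / 2 ^ card (B \<inter> behind \<sigma> y)))"
    by (intro sum_mono miss Int_lower1)
  also have "\<dots> = (\<Sum>y\<in>D. card ?L * (\<Sum>\<sigma>\<in>?P. min 1 (2 ^ m / 2 ^ card (B \<inter> behind \<sigma> y))))"
    by (simp only: sum_distrib_left)
  also have "\<dots> = (\<Sum>y\<in>D. card ?L * (fact (card S) / (card B + 1) * (\<Sum>j<card B + 1. min 1 (2 ^ m / 2 ^ j))))"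
    by (intro sum.cong refl) (simp only: behind)
  also have "\<dots> \<le> (\<Sum>y\<in>D. card ?L * (fact (card S) / (card B + 1) * (m + 2)))"
    by (intro sum_mono mult_left_mono sum_min_one_le) simp_all
  also have "\<dots> = (\<Sum>r\<in>?L. U)"
    by (simp add: U_def)
  finally have "\<not> (\<Sum>r\<in>?L. U) < (\<Sum>r\<in>?L. ?F r)"
    by (simp only: not_less)
  then obtain r where "?F r \<le> U"
    using sum_strict_mono[OF finL neL, of "\<lambda>_. U" ?F] not_le by blast
  moreover have "\<forall>y\<in>D. c r y = e y"
    by (simp add: c_def)
  ultimately show ?thesis
    unfolding U_def by blast
qed

section \<open>The steering protocol\<close>

definition zero_sum :: "(nat \<Rightarrow> nat \<Rightarrow> bit) \<Rightarrow> (nat \<Rightarrow> bool option) \<Rightarrow> nat \<Rightarrow> bit" where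
  "zero_sum c f i = (\<Sum>y | f y = Some False. c y i)"

definition steer :: "nat \<Rightarrow> (nat \<Rightarrow> nat \<Rightarrow> bit) \<Rightarrow> nat set \<Rightarrow> (nat \<Rightarrow> bool option) \<Rightarrow> nat \<Rightarrow> bool" where
  "steer m c B f x \<longleftrightarrow> (\<lambda>i. zero_sum c f i + c x i) \<notin> lspan m c (B - dom f - {x})"

lemma zero_sum_update:
  assumes "finite (dom f)" "x \<notin> dom f"
  shows "zero_sum c (f(x \<mapsto> b)) = (\<lambda>i. zero_sum c f i + (if b then 0 else c x i))"
proof -
  have fin: "finite {y. f y = Some False}"
    by (rule finite_subset[OF _ assms(1)]) auto
  have "{y. (f(x \<mapsto> b)) y = Some False} =
      (if b then {y. f y = Some False} else insert x {y. f y = Some False})"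
    using assms(2) by (auto simp: dom_def)
  then show ?thesis
    using fin assms(2) by (auto simp: zero_sum_def fun_eq_iff add.commute)
qed

text \<open>The invariant of steering. Writing 0 keeps it by the choice in \<open>steer\<close>;
  when 0 would break it, \<open>lspan_remove\<close> shows that leaving the sum unchanged by writing
  1 is safe.\<close>

lemma zero_sum_run:
  assumes "distinct ps"
  shows "zero_sum c (run (steer m c B) ps) \<in> lspan m c (B - set ps)"
  using assms
proof (induction ps rule: rev_induct)
  case Nil
  then show ?case by (simp add: zero_sum_def lspan_def dot_def)
next
  case (snoc x ps)
  let ?f = "run (steer m c B) ps"
  have f: "zero_sum c ?f \<in> lspan m c (B - set ps)" and x: "x \<notin> dom ?f"
    using snoc by auto
  have "B - set (ps @ [x]) = B - set ps - {x}"
    by auto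
  moreover have "zero_sum c (?f(x \<mapsto> steer m c B ?f x)) \<in> lspan m c (B - set ps - {x})"
  proof (cases "steer m c B ?f x")
    case True
    then show ?thesis
      using lspan_remove[OF f, of x] x by (simp add: zero_sum_update steer_def)
  next
    case False
    then show ?thesis
      using x by (simp add: zero_sum_update steer_def)
  qed
  ultimately show ?case
    by (simp only: run_snoc)
qed

text \<open>Elements of \<open>bvecs m\<close> are \<open>undefined\<close> outside
  \<open>{..<m}\<close>, so the zero vector among them is the restricted zero function.\<close>

lemma lspan_empty_nonzero:
  assumes "t \<in> bvecs m" "t \<noteq> restrict (\<lambda>_. 0) {..<m}"
  shows "t \<notin> lspan m c {}"
proof
  assume "t \<in> lspan m c {}"
  then have "\<And>i. i < m \<Longrightarrow> t i = restrict (\<lambda>_. 0) {..<m} i"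
    by (simp add: lspan_empty_iff)
  moreover have "restrict (\<lambda>_. 0) {..<m} \<in> bvecs m"
    by (simp add: bvecs_def)
  ultimately show False
    using assms bvecs_eqI by blast
qed

lemma final_array_oblivious_protocol:
  assumes "distinct (ps @ [x])"
  shows "final_array (oblivious_protocol g) (ps @ [x]) b = (run g ps)(x \<mapsto> b)"
  using assms by (simp add: final_array_def partial_assign_oblivious_protocol)

text \<open>Once all of \<open>B\<close> is filled, the invariant confines the sum to the trivial
  span, so only the last cell can contribute.\<close>

lemma zero_sum_final:
  assumes "distinct (ps @ [x])" "B \<subseteq> set ps" "i < m"
  shows "zero_sum c ((run (steer m c B) ps)(x \<mapsto> b)) i = (if b then 0 else c x i)"
proof -
  have "distinct ps" "x \<notin> set ps"
    using assms(1) by simp_all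
  have "B - set ps = {}"
    using assms(2) by blast
  then have "zero_sum c (run (steer m c B) ps) \<in> lspan m c {}"
    using zero_sum_run[OF \<open>distinct ps\<close>, of c m B] by (simp only: \<open>B - set ps = {}\<close>)
  then have "zero_sum c (run (steer m c B) ps) i = 0"
    using assms(3) by (simp add: lspan_empty_iff)
  then show ?thesis
    using \<open>x \<notin> set ps\<close> by (simp add: zero_sum_update)
qed

text \<open>Filling \<open>y\<close> outside \<open>B\<close> leaves the empty cells of
  \<open>B\<close> unchanged, and the current sum already lies in their span. So whether 0 is
  allowed depends on \<open>c y\<close> alone.\<close>

lemma run_steer_ones:
  assumes dist: "distinct (ps @ [x])" and B: "B \<subseteq> set ps"
    and y: "y \<in> set ps" "y \<notin> B"
  shows "run (steer m c B) ps y = Some (c y \<notin> lspan m c (B \<inter> behind (ps @ [x]) y))"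
proof -
  obtain p q where ps: "ps = p @ y # q"
    using split_list[OF y(1)] by blast
  have d: "distinct (p @ y # q)" "x \<notin> set (p @ y # q)"
    using dist unfolding ps by simp_all
  have "behind (p @ y # (q @ [x])) y = set (q @ [x])"
    using d by (intro behind_append_Cons) auto
  then have "behind (ps @ [x]) y = insert x (set q)"
    by (simp add: ps)
  moreover have "B \<inter> insert x (set q) = B - set p"
    using d B y(2) unfolding ps by auto
  ultimately have beh: "B \<inter> behind (ps @ [x]) y = B - set p"
    by simp
  have "B - set p - {y} = B - set p"
    using y(2) by blast
  then have "steer m c B (run (steer m c B) p) y \<longleftrightarrow> c y \<notin> lspan m c (B - set p)"
    using zero_sum_run[of p c m B] d by (simp add: steer_def lspan_add_iff)
  then show ?thesis
    using run_append_Cons[OF d(1), of "steer m c B"] by (simp add: ps[symmetric] beh)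
qed

text \<open>Bob's guessing distribution; the entropy is at most the expected logarithm of the inverse of the
  probability that it gives to the last cell.\<close>

definition bet :: "nat \<Rightarrow> (nat \<Rightarrow> nat \<Rightarrow> bit) \<Rightarrow> nat set \<Rightarrow> nat set \<Rightarrow> nat \<Rightarrow> (nat \<Rightarrow> bool option) \<Rightarrow> real"
  where "bet m c D B x v =
    (if x \<in> B then 1 / (2 * card B)
     else if \<forall>i<m. zero_sum c v i = 0 then
       (if v x = Some True then 1 / (2 * card {y \<in> D. v y = Some True}) else 0)
     else if \<forall>i<m. zero_sum c v i = c x i then 1 / 2 else 0)"

text \<open>Half of the mass is reserved for \<open>B\<close>. The other half goes to
  \<open>D\<close>: spread over its ones if the sum is zero, otherwise put on the at most one cell
  whose label equals the sum.\<close>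

lemma sum_bet_le_1:
  assumes fin: "finite D" "finite B" and disj: "D \<inter> B = {}"
    and c: "inj_on c D" "c ` D \<subseteq> bvecs m"
  shows "(\<Sum>x\<in>D \<union> B. bet m c D B x v) \<le> 1"
proof -
  have "(\<Sum>x\<in>B. bet m c D B x v) \<le> 1 / 2"
    by (simp add: bet_def)
  moreover have "(\<Sum>x\<in>D. bet m c D B x v) \<le> 1 / 2"
  proof (cases "\<forall>i<m. zero_sum c v i = 0")
    case True
    let ?O = "{y \<in> D. v y = Some True}"
    have "(\<Sum>x\<in>D. bet m c D B x v) = (\<Sum>x\<in>D. if v x = Some True then 1 / (2 * real (card ?O)) else 0)"
      using disj True by (intro sum.cong refl) (auto simp: bet_def)
    also have "\<dots> = (\<Sum>x\<in>?O. 1 / (2 * real (card ?O)))"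
      by (rule sum.inter_filter[OF fin(1), symmetric])
    also have "\<dots> \<le> 1 / 2"
      by simp
    finally show ?thesis .
  next
    case False
    let ?O = "{x \<in> D. \<forall>i<m. zero_sum c v i = c x i}"
    have "x = y" if "x \<in> ?O" "y \<in> ?O" for x y
    proof -
      have "c x = c y"
        using that c(2) by (intro bvecs_eqI[of _ m]) auto
      then show ?thesis
        using that c(1) by (simp add: inj_on_def)
    qed
    then have card: "card ?O \<le> 1"
      using fin(1) by (simp add: card_le_Suc0_iff_eq)
    have "(\<Sum>x\<in>D. bet m c D B x v) = (\<Sum>x\<in>D. if \<forall>i<m. zero_sum c v i = c x i then 1 / 2 else 0)"
      using disj False by (intro sum.cong refl) (auto simp: bet_def)
    also have "\<dots> = (\<Sum>x\<in>?O. 1 / 2)"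
      by (rule sum.inter_filter[OF fin(1), symmetric])
    also have "\<dots> \<le> 1 / 2"
      using card by simp
    finally show ?thesis .
  qed
  moreover have "(\<Sum>x\<in>D \<union> B. bet m c D B x v) = (\<Sum>x\<in>D. bet m c D B x v) + (\<Sum>x\<in>B. bet m c D B x v)"
    using fin disj by (rule sum.union_disjoint)
  ultimately show ?thesis
    by linarith
qed

lemma bet_final_array:
  assumes \<sigma>: "\<sigma> \<in> permutations_of_set (D \<union> B)" "last \<sigma> \<in> D"
    and fin: "finite D" and disj: "D \<inter> B = {}"
    and c: "c ` D \<subseteq> bvecs m - {restrict (\<lambda>_. 0) {..<m}}"
  shows "late_count m c D B \<sigma> > 0"
    and "bet m c D B (last \<sigma>) (final_array (oblivious_protocol (steer m c B)) \<sigma> b) =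
      (if b then 1 / (2 * late_count m c D B \<sigma>) else 1 / 2)"
proof -
  define x where "x = last \<sigma>"
  define ps where "ps = butlast \<sigma>"
  have set\<sigma>: "set \<sigma> = D \<union> B" and dist\<sigma>: "distinct \<sigma>"
    using \<sigma>(1) by (simp_all add: permutations_of_set_def)
  have "\<sigma> \<noteq> []"
    using set\<sigma> \<sigma>(2) by auto
  then have \<sigma>_eq: "\<sigma> = ps @ [x]"
    by (simp add: ps_def x_def)
  have xD: "x \<in> D" and xB: "x \<notin> B"
    using \<sigma>(2) disj by (auto simp: x_def)
  have dist: "distinct (ps @ [x])" and xps: "x \<notin> set ps"
    using dist\<sigma> by (simp_all add: \<sigma>_eq)
  have Bps: "B \<subseteq> set ps"
    using set\<sigma> xB by (auto simp: \<sigma>_eq)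
  have "behind \<sigma> x = {}"
    using behind_append_Cons[of x "[]" ps] by (simp add: \<sigma>_eq)
  \<comment> \<open>Nothing is behind the last cell, so its nonzero label is outside the trivial
    span: \<open>x\<close> counts as late, matching the 1 it holds when \<open>b\<close> is
    1.\<close>
  then have x_late: "c x \<notin> lspan m c (B \<inter> behind \<sigma> x)"
    using lspan_empty_nonzero[of "c x" m c] c xD by auto
  then have x_mem: "x \<in> {y \<in> D. c y \<notin> lspan m c (B \<inter> behind \<sigma> y)}"
    using xD by simp
  then show "late_count m c D B \<sigma> > 0"
    using fin unfolding late_count_def by (auto simp: card_gt_0_iff)
  define v where "v = final_array (oblivious_protocol (steer m c B)) \<sigma> b"
  have v: "v = (run (steer m c B) ps)(x \<mapsto> b)"
    unfolding v_def \<sigma>_eq by (rule final_array_oblivious_protocol[OF dist])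
  have zs: "zero_sum c v i = (if b then 0 else c x i)" if "i < m" for i
    unfolding v by (rule zero_sum_final[OF dist Bps that])
  have "bet m c D B x v = (if b then 1 / (2 * late_count m c D B \<sigma>) else 1 / 2)"
  proof (cases b)
    case True
    have "v y = Some True \<longleftrightarrow> c y \<notin> lspan m c (B \<inter> behind \<sigma> y)" if "y \<in> D" for y
    proof (cases "y = x")
      case True
      then show ?thesis
        using x_late \<open>b\<close> by (simp add: v)
    next
      case False
      then have "y \<in> set ps" "y \<notin> B"
        using that set\<sigma> disj by (auto simp: \<sigma>_eq)
      then show ?thesis
        using run_steer_ones[OF dist Bps] False by (simp add: v \<sigma>_eq)
    qed
    then have "{y \<in> D. v y = Some True} = {y \<in> D. c y \<notin> lspan m c (B \<inter> behind \<sigma> y)}"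
      by (intro Collect_cong conj_cong refl)
    then have "card {y \<in> D. v y = Some True} = late_count m c D B \<sigma>"
      by (simp add: late_count_def)
    moreover have "v x = Some True"
      using True by (simp add: v)
    ultimately show ?thesis
      using True xB zs by (simp add: bet_def)
  next
    case False
    have "v x = Some b"
      by (simp add: v)
    \<comment> \<open>A nonzero label keeps \<open>bet\<close> out of its zero-sum branch, so Bob
      recognises \<open>x\<close> by its label.\<close>
    have "\<not> (\<forall>i<m. c x i = 0)"
      using lspan_empty_nonzero[of "c x" m c] c xD unfolding lspan_empty_iff by blast
    then show ?thesis
      using False xB zs \<open>v x = Some b\<close> by (simp add: bet_def)
  qed  then show "bet m c D B (last \<sigma>) (final_array (oblivious_protocol (steer m c B)) \<sigma> b) =
      (if b then 1 / (2 * late_count m c D B \<sigma>) else 1 / 2)"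
    by (simp only: x_def v_def)
qed

text \<open>The leading 1 pays for the factor 1/2 present in every bet. In \<open>D\<close> the
  remaining logarithm is paid only for \<open>b = 1\<close>, hence halved; in \<open>B\<close> it is
  paid for both bits.\<close>

lemma h_tilde_steer_le:
  assumes n: "n \<ge> 1" "D \<union> B = {1..n}" and disj: "D \<inter> B = {}"
    and c: "inj_on c D" "c ` D \<subseteq> bvecs m - {restrict (\<lambda>_. 0) {..<m}}"
  shows "h_tilde n (oblivious_protocol (steer m c B)) \<le> 1 +
    (\<Sum>\<sigma>\<in>permutations_of_set {1..n}.
      if last \<sigma> \<in> D then log 2 (late_count m c D B \<sigma>) / 2 else log 2 (card B)) / fact n"
proof -
  let ?A = "oblivious_protocol (steer m c B)"
  let ?P = "permutations_of_set {1..n}"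
  let ?q = "bet m c D B"
  let ?F = "\<lambda>\<sigma>. if last \<sigma> \<in> D then log 2 (late_count m c D B \<sigma>) / 2 else log 2 (card B)"
  have fin: "finite D" "finite B"
    using n(2) by (metis finite_Un finite_atLeastAtMost)+
  have last: "last \<sigma> \<in> D \<union> B" if "\<sigma> \<in> ?P" for \<sigma>
  proof -
    have "set \<sigma> = D \<union> B"
      using that n(2) by (simp add: permutations_of_set_def)
    moreover have "\<sigma> \<noteq> []"
      using n(1) that by (auto simp: permutations_of_set_def)
    ultimately show ?thesis
      using last_in_set by blast
  qed
  have inB: "?q (last \<sigma>) v = 1 / (2 * card B)" "card B > 0" if "last \<sigma> \<in> B" for \<sigma> v
    using that fin by (auto simp: bet_def card_gt_0_iff)
  have inD: "late_count m c D B \<sigma> > 0"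
    "?q (last \<sigma>) (final_array ?A \<sigma> b) = (if b then 1 / (2 * late_count m c D B \<sigma>) else 1 / 2)"
    if "\<sigma> \<in> ?P" "last \<sigma> \<in> D" for \<sigma> b
    using bet_final_array[of \<sigma> D B c m] that fin(1) disj c(2) n(2) by simp_all
  have "h_tilde n ?A \<le>
    (\<Sum>(\<sigma>, b)\<in>outcomes n. log 2 (1 / ?q (last \<sigma>) (final_array ?A \<sigma> b))) / card (outcomes n)"
  proof (rule h_tilde_le_cross_entropy)
    show "0 \<le> ?q x v" for x v
      by (simp add: bet_def)
    show "0 < ?q (last \<sigma>) (final_array ?A \<sigma> b)" if "\<sigma> \<in> ?P" for \<sigma> b
      using last[OF that] inB[of \<sigma>] inD[OF that] by (cases "last \<sigma> \<in> B") simp_all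
    show "(\<Sum>x\<in>{1..n}. ?q x v) \<le> 1" for v
      using sum_bet_le_1[OF fin disj c(1), of m v] c(2) n(2) by auto
  qed (rule n)
  also have "(\<Sum>(\<sigma>, b)\<in>outcomes n. log 2 (1 / ?q (last \<sigma>) (final_array ?A \<sigma> b))) =
      (\<Sum>\<sigma>\<in>?P. \<Sum>b\<in>UNIV. log 2 (1 / ?q (last \<sigma>) (final_array ?A \<sigma> b)))"
    unfolding outcomes_def by (rule sum.cartesian_product[symmetric])
  also have "\<dots> = (\<Sum>\<sigma>\<in>?P. 2 * (1 + ?F \<sigma>))"
  proof (rule sum.cong[OF refl])
    fix \<sigma> assume \<sigma>: "\<sigma> \<in> ?P"
    show "(\<Sum>b\<in>UNIV. log 2 (1 / ?q (last \<sigma>) (final_array ?A \<sigma> b))) = 2 * (1 + ?F \<sigma>)"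
    proof (cases "last \<sigma> \<in> D")
      case True
      then show ?thesis
        using inD[OF \<sigma> True] by (simp add: UNIV_bool log_mult)
    next
      case False
      then have "last \<sigma> \<in> B"
        using last[OF \<sigma>] by simp
      then show ?thesis
        using inB[of \<sigma>] False by (simp add: UNIV_bool log_mult)
    qed
  qed
  also have "\<dots> = 2 * (fact n + (\<Sum>\<sigma>\<in>?P. ?F \<sigma>))"
    by (simp only: sum_distrib_left[symmetric] sum.distrib) simp
  also have "real (card (outcomes n)) = 2 * fact n"
    unfolding outcomes_def card_cartesian_product by simp
  also have "2 * (fact n + (\<Sum>\<sigma>\<in>?P. ?F \<sigma>)) / (2 * fact n) = 1 + (\<Sum>\<sigma>\<in>?P. ?F \<sigma>) / fact n"
    by (simp add: field_simps)
  finally show ?thesis .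
qed

section \<open>Choice of parameters and final estimate\<close>

lemma card_permutations_last_in:
  assumes S: "finite S" "S \<noteq> {}" and D: "D \<subseteq> S"
  shows "real (card {\<sigma> \<in> permutations_of_set S. last \<sigma> \<in> D}) = card D * (fact (card S) / card S)"
proof -
  let ?E = "\<lambda>x. {\<sigma> \<in> permutations_of_set S. last \<sigma> = x}"
  have fin: "finite D"
    using S D finite_subset by blast
  have E: "real (card (?E x)) = fact (card S) / card S" if "x \<in> D" for x
  proof -
    have "x \<in> S"
      using that D by blast
    then have "real (card (?E x) * card S) = real (fact (card S))"
      by (simp only: card_permutations_last[OF S(1)])
    then show ?thesis
      using S by (simp add: eq_divide_eq)
  qed
  have "{\<sigma> \<in> permutations_of_set S. last \<sigma> \<in> D} = (\<Union>x\<in>D. ?E x)"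
    by blast
  also have "card \<dots> = (\<Sum>x\<in>D. card (?E x))"
    using fin S by (intro card_UN_disjoint) auto
  finally show ?thesis
    by (simp add: E)
qed

theorem theorem1:
  fixes n :: nat
  assumes "n \<ge> 1"
  shows "\<exists>A :: protocol. order_oblivious n A \<and>
           h_tilde n A \<le> 3 + real_of_int \<lceil>log 2 (log 2 (real n))\<rceil>"
proof -
  define l where "l = nat \<lceil>log 2 (log 2 (real n))\<rceil>"
  define k :: nat where "k = 2 ^ l"
  \<comment> \<open>The extra coordinate gives \<open>n < 2 ^ m\<close>, enough nonzero vectors to
    label \<open>D\<close> injectively.\<close>
  define m where "m = k + 1"
  define a where "a = n div k"
  define D where "D = {1..n - a}"
  define B where "B = {n - a<..n}"
  \<comment> \<open>The product of the bounds \<open>n / (a + 1) \<le> k\<close> and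
    \<open>m + 2 \<le> 4 * k\<close> for the factors in \<open>exists_labelling\<close>. It is a
    power of two, so its logarithm is exact.\<close>
  define M :: real where "M = 4 * real k ^ 2"
  let ?P = "permutations_of_set {1..n}"
  have k: "k \<ge> 1"
    by (simp add: k_def)
  have l: "real_of_int \<lceil>log 2 (log 2 (real n))\<rceil> = real l"
  proof -
    have "0 \<le> log 2 (log 2 (real n))"
    \<comment> \<open>For \<open>n = 1\<close> the outer logarithm is \<open>log 2 0\<close>, which
      is 0 by convention; otherwise the inner one is at least 1.\<close>
    proof (cases "n = 1")
      case False
      then have "log 2 2 \<le> log 2 (real n)"
        using assms by (subst log_le_cancel_iff) auto
      then show ?thesis
        by simp
    qed (simp add: log_def)
    then show ?thesis
      by (simp add: l_def)
  qed
  have logn: "log 2 (real n) \<le> k"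
  proof (cases "log 2 (real n) > 0")
    case True
    have "log 2 (log 2 (real n)) \<le> real l"
      unfolding l[symmetric] by (rule le_of_int_ceiling)
    then have "log 2 (real n) \<le> 2 powr real l"
      using True by (simp add: log_le_iff)
    then show ?thesis
      by (simp add: k_def powr_realpow)
  qed (use k in simp)
  have nk: "n < 2 ^ m"
  proof -
    have "real n \<le> 2 powr real k"
      using logn assms by (simp add: log_le_iff)
    then have "real n \<le> real (2 ^ k)"
      by (simp add: powr_realpow)
    then have "n \<le> 2 ^ k"
      by (simp only: of_nat_le_iff)
    also have "(2::nat) ^ k < 2 ^ m"
      by (simp add: m_def)
    finally show ?thesis .
  qed
  have an: "a \<le> n"
    by (simp add: a_def)
  have DB: "D \<union> B = {1..n}" "D \<inter> B = {}"
    using an by (auto simp: D_def B_def)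
  have cardD: "card D = n - a" and cardB: "card B = a"
    using an by (simp_all add: D_def B_def)
  let ?V = "bvecs m - {restrict (\<lambda>_. 0) {..<m}}"
  have "card ?V = 2 ^ m - 1"
    by (subst card_Diff_singleton) (simp_all add: card_bvecs, simp add: bvecs_def)
  then have "card D \<le> card ?V"
    using nk by (simp add: cardD)
  then obtain e where e: "e ` D \<subseteq> ?V" "inj_on e D"
    using card_le_inj[of D ?V] by (auto simp: D_def)
  obtain c where c: "\<forall>y\<in>D. c y = e y" and
    "(\<Sum>\<sigma>\<in>?P. real (late_count m c D B \<sigma>)) \<le> card D * (fact (card {1..n}) / (card B + 1) * real (m + 2))"
    using exists_labelling[of "{1..n}" D B e m] DB by auto
  then have late: "(\<Sum>\<sigma>\<in>?P. real (late_count m c D B \<sigma>)) \<le> card D * (fact n / (a + 1) * real (m + 2))"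
    by (simp add: cardB)
  have "inj_on c D" "c ` D \<subseteq> ?V"
    using e c by (simp_all add: inj_on_def image_subset_iff)
  have h: "h_tilde n (oblivious_protocol (steer m c B)) \<le> 1 + (\<Sum>\<sigma>\<in>?P.
      if last \<sigma> \<in> D then log 2 (late_count m c D B \<sigma>) / 2 else log 2 a) / fact n"
    using h_tilde_steer_le[OF assms DB \<open>inj_on c D\<close> \<open>c ` D \<subseteq> ?V\<close>] by (simp only: cardB)
  have M: "M > 0"
    using k by (simp add: M_def)
  have logM: "log 2 M = 2 + 2 * real l"
  proof -
    have M_eq: "M = 2 ^ (2 + 2 * l)"
      by (simp add: M_def k_def power_add power_even_eq)
    have "log 2 M = real (2 + 2 * l)"
      unfolding M_eq by (rule log_pow_cancel) simp_all
    then show ?thesis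
      by simp
  qed
  \<comment> \<open>The tangent of the concave logarithm at \<open>M\<close> replaces Jensen's
    inequality: a bound on the sum of the late counts then suffices.\<close>
  have tangent: "log 2 (real N) \<le> log 2 M + (N / M - 1) / ln 2" if "N > 0" for N :: nat
  proof -
    have "ln (real N / M) \<le> N / M - 1"
      using that M by (intro ln_le_minus_one) simp
    then have "(ln (real N) - ln M) / ln 2 \<le> (N / M - 1) / ln 2"
      using that M by (intro divide_right_mono) (simp_all add: ln_div)
    then show ?thesis
      by (simp add: log_def diff_divide_distrib)
  qed
  have nM: "real n * real (m + 2) \<le> (a + 1) * M"
  proof -
    have "n = k * a + n mod k" "n mod k < k"
      using k by (simp_all add: a_def)
    then have "n \<le> k * (a + 1)"
      by simp
    moreover have "m + 2 \<le> 4 * k"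
      using k by (simp add: m_def)
    ultimately have "n * (m + 2) \<le> k * (a + 1) * (4 * k)"
      by (rule mult_le_mono)
    then have "real (n * (m + 2)) \<le> real (k * (a + 1) * (4 * k))"
      by (simp only: of_nat_le_iff)
    then show ?thesis
      by (simp add: M_def power2_eq_square algebra_simps)
  qed
  define G where "G = real (card {\<sigma> \<in> ?P. last \<sigma> \<in> D})"
  define G' where "G' = real (card {\<sigma> \<in> ?P. last \<sigma> \<notin> D})"
  have "{1..n} \<noteq> {}"
    using assms by simp
  then have G: "G = (n - a) * (fact n / n)"
    using card_permutations_last_in[of "{1..n}" D] DB(1) by (auto simp: G_def cardD)
  have G': "G' = a * (fact n / n)"
  proof -
    have "G + G' = real (card ({\<sigma> \<in> ?P. last \<sigma> \<in> D} \<union> {\<sigma> \<in> ?P. last \<sigma> \<notin> D}))"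
      unfolding G_def G'_def by (subst card_Un_disjoint) auto
    also have "{\<sigma> \<in> ?P. last \<sigma> \<in> D} \<union> {\<sigma> \<in> ?P. last \<sigma> \<notin> D} = ?P"
      by blast
    also have "real (card ?P) = fact n"
      by simp
    finally show ?thesis
      using an assms by (simp add: G of_nat_diff field_simps)
  qed
  let ?N = "late_count m c D B"
  have late_le: "(\<Sum>\<sigma>\<in>?P. real (?N \<sigma>)) \<le> G * M"
  proof -
    have "fact n / (a + 1) * real (m + 2) \<le> fact n / n * M"
      using mult_left_mono[OF nM, of "fact n"] assms by (simp add: field_simps)
    then have "card D * (fact n / (a + 1) * real (m + 2)) \<le> card D * (fact n / n * M)"
      by (rule mult_left_mono) simp
    then show ?thesis
      using late by (simp add: G cardD)
  qed
  have pos: "?N \<sigma> > 0" if "\<sigma> \<in> ?P" "last \<sigma> \<in> D" for \<sigma>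
    using bet_final_array(1)[of \<sigma> D B c m] that DB \<open>c ` D \<subseteq> ?V\<close> by (simp add: D_def)
  \<comment> \<open>The linear term is added for permutations ending in \<open>B\<close> too, where
    it is nonnegative, because \<open>late_le\<close> sums over all permutations.\<close>
  have "(\<Sum>\<sigma>\<in>?P. if last \<sigma> \<in> D then log 2 (?N \<sigma>) / 2 else log 2 a)
      \<le> (\<Sum>\<sigma>\<in>?P. (if last \<sigma> \<in> D then (log 2 M - 1 / ln 2) / 2 else log 2 a) + ?N \<sigma> / (2 * M * ln 2))"
  proof (rule sum_mono)
    fix \<sigma> assume \<sigma>: "\<sigma> \<in> ?P"
    show "(if last \<sigma> \<in> D then log 2 (?N \<sigma>) / 2 else log 2 a)
      \<le> (if last \<sigma> \<in> D then (log 2 M - 1 / ln 2) / 2 else log 2 a) + ?N \<sigma> / (2 * M * ln 2)"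
    proof (cases "last \<sigma> \<in> D")
      case True
      have "(log 2 M + (?N \<sigma> / M - 1) / ln 2) / 2 = (log 2 M - 1 / ln 2) / 2 + ?N \<sigma> / (2 * M * ln 2)"
        by (simp add: field_simps)
      then show ?thesis
        using tangent[OF pos[OF \<sigma> True]] True by simp
    next
      case False
      then show ?thesis
        using M by simp
    qed
  qed
  also have "\<dots> = G * ((log 2 M - 1 / ln 2) / 2) + G' * log 2 a + (\<Sum>\<sigma>\<in>?P. real (?N \<sigma>)) / (2 * M * ln 2)"
    unfolding G_def G'_def sum.distrib sum_divide_distrib
    by (simp add: sum.If_cases Int_def)
  also have "\<dots> \<le> G * ((log 2 M - 1 / ln 2) / 2) + G' * log 2 a + G * M / (2 * M * ln 2)"
    using late_le M by (intro add_left_mono divide_right_mono) simp_all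
  \<comment> \<open>The two corrections \<open>G / (2 * ln 2)\<close> from the tangent cancel,
    leaving \<open>G * log 2 M / 2\<close>.\<close>
  also have "\<dots> = G * (1 + real l) + G' * log 2 a"
    using M by (simp add: logM field_simps)
  finally have "(\<Sum>\<sigma>\<in>?P. if last \<sigma> \<in> D then log 2 (?N \<sigma>) / 2 else log 2 a) / fact n
      \<le> (G * (1 + real l) + G' * log 2 a) / fact n"
    by (rule divide_right_mono) simp
  also have "\<dots> = real (n - a) / n * (1 + real l) + a * log 2 a / n"
    by (simp add: G G' field_simps)
  \<comment> \<open>Cells of \<open>D\<close> cost at most \<open>1 + l\<close>. Cells of
    \<open>B\<close> cost at most 1, since \<open>log 2 a \<le> k\<close> and
    \<open>a * k \<le> n\<close>. With the 1 in \<open>h\<close> this makes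
    \<open>3 + l\<close>.\<close>
  also have "\<dots> \<le> 1 * (1 + real l) + 1"
  proof (rule add_mono)
    show "real (n - a) / n * (1 + real l) \<le> 1 * (1 + real l)"
      using assms by (intro mult_right_mono) simp_all
    have "a * log 2 a \<le> real n"
    proof (cases "a = 0")
      case False
      then have "log 2 a \<le> log 2 n"
        using an by (subst log_le_cancel_iff) simp_all
      then have "a * log 2 a \<le> real a * k"
        using logn by (intro mult_left_mono) simp_all
      also have "\<dots> \<le> real n"
        unfolding of_nat_mult[symmetric] of_nat_le_iff a_def by (rule div_times_less_eq_dividend)
      finally show ?thesis .
    qed simp
    then show "a * log 2 a / n \<le> 1"
      using assms by (simp add: divide_le_eq)
  qed
  finally have "h_tilde n (oblivious_protocol (steer m c B)) \<le> 3 + real l"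
    using h by simp
  then show ?thesis
    unfolding l using order_oblivious_oblivious_protocol by blast
qed

end
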